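(* Let $n\geq 3$ be an integer. Let $\mathcal{D}$ be a division ring with $\mathrm{char}(\mathcal{D})>n$ or $\mathrm{char}(\mathcal{D})=0$. Let $f,g:\mathcal{D}\rightarrow \mathcal{D}$ be additive maps satisfying the identity \[ f(x)+x^n g(x^{-1})=0 \] for all $x\in \mathcal{D}^{\times}$. Then $f=0$ and $g=0$.
   Context: Division rings are associative and not necessarily commutative. $\mathcal{D}^{\times}$ denotes the set of all invertible (i.e. nonzero) elements of $\mathcal{D}$. A map is additive if it is a homomorphism of additive groups. *)

theory Defs
  imports Complex_Main
begin

end

theory Submission
  imports Defs
begin

text \<open>Why the theorem holds. All powers of \<open>x\<close> and \<open>x + 1\<close> commute, and partial fractions give
  \<open>1/x - 1/(x + 1) = 1/(x\<^sup>2 + x)\<close>. Applying \<open>g\<close>, replacing each value \<open>g(1/y)\<close> by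
  \<open>- f(y)/y\<^sup>n\<close> (with the power of \<open>y\<close> on the left) and clearing denominators eliminates \<open>g\<close>:
  \<open>f(x\<^sup>2) = ((x + 1)\<^sup>n - x\<^sup>n - 1) f(x) - x\<^sup>n f(1)\<close>, which is \<open>additive_square_identity\<close>.

  The two sides scale differently, and this is decisive. Substituting \<open>k x\<close> for \<open>x\<close>, with
  \<open>k = 0, \<dots>, n\<close>, turns the relation into a polynomial equation of degree \<open>n\<close> in \<open>k\<close>,
  because \<open>x\<^sup>n\<close> cancels in \<open>(x + 1)\<^sup>n - x\<^sup>n - 1\<close>. The hypothesis on the characteristic makes
  these \<open>n + 1\<close> central scalars distinct, so the leading coefficient vanishes
  (\<open>leading_coeff_eq_0_if_central_roots\<close>). Since \<open>n \<ge> 3\<close>, the term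
  \<open>f((k x)\<^sup>2) = k\<^sup>2 f(x\<^sup>2)\<close> does not reach degree \<open>n\<close>, and what remains there is
  \<open>n x\<^sup>n\<^sup>-\<^sup>1 f(x) = x\<^sup>n f(1)\<close>. At \<open>x = 1\<close> this says \<open>(n - 1) f(1) = 0\<close>. The integers
  \<open>n - 1\<close> and \<open>n\<close> are invertible, so \<open>f(1) = 0\<close> and then \<open>f = 0\<close>; the original identity now
  gives \<open>g = 0\<close>.\<close>

lemma power_mult_distrib_commuting:
  fixes x y :: "'a::monoid_mult"
  assumes "x * y = y * x"
  shows "(x * y) ^ n = x ^ n * y ^ n"
proof (induction n)
  case (Suc n)
  have "x * y * (x ^ n * y ^ n) = x * (y * x ^ n) * y ^ n" by (simp add: mult.assoc)
  also have "y * x ^ n = x ^ n * y" using power_commuting_commutes[OF assms] by simp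
  finally show ?case by (simp add: Suc mult.assoc)
qed simp

lemma diff_power_eq_commuting:
  fixes x a :: "'a::ring_1"
  assumes "x * a = a * x"
  shows "x ^ i - a ^ i = (x - a) * (\<Sum>j<i. x ^ j * a ^ (i - Suc j))"
proof (induction i)
  case 0
  show ?case by simp
next
  case (Suc i)
  have "(\<Sum>j<i. x ^ j * a ^ (Suc i - Suc j)) = (\<Sum>j<i. x ^ j * a ^ (i - Suc j)) * a"
    unfolding sum_distrib_right
    by (rule sum.cong) (auto simp: Suc_diff_Suc power_Suc2[symmetric] mult.assoc simp del: power_Suc)
  then have "(x - a) * (\<Sum>j<Suc i. x ^ j * a ^ (Suc i - Suc j))
      = (x ^ i - a ^ i) * a + (x - a) * x ^ i"
    by (simp add: Suc distrib_left mult.assoc)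
  also have "\<dots> = x ^ Suc i - a ^ Suc i"
    using power_commuting_commutes[OF assms, of i]
    by (simp add: algebra_simps power_commutes)
  finally show ?case by simp
qed

text \<open>Roots are counted as over a field: dividing by \<open>x - a\<close> for a root \<open>a\<close> drops the degree and
  keeps the leading coefficient. As \<open>x\<close> and \<open>a\<close> are central, the factor \<open>x - a\<close> comes out on
  the left whatever the coefficients are.\<close>

lemma leading_coeff_eq_0_if_central_roots:
  fixes c :: "nat \<Rightarrow> 'a::ring_1_no_zero_divisors"
  assumes "card S > n"
    and central: "\<And>x y. x \<in> S \<Longrightarrow> x * y = y * x"
    and root: "\<And>x. x \<in> S \<Longrightarrow> (\<Sum>i\<le>n. x ^ i * c i) = 0"
  shows "c n = 0"
  using assms
proof (induction n arbitrary: c S)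
  case 0
  then obtain x where "x \<in> S" by fastforce
  with "0.prems"(3) show ?case by fastforce
next
  case (Suc n)
  obtain a where a: "a \<in> S" using Suc.prems(1) by fastforce
  \<comment> \<open>The coefficients of the quotient by \<open>x - a\<close>\<close>
  define d where "d j = (\<Sum>i=Suc j..Suc n. a ^ (i - Suc j) * c i)" for j
  have "d n = 0"
  proof (rule Suc.IH)
    show "card (S - {a}) > n" using Suc.prems(1) a by simp
    show "x * y = y * x" if "x \<in> S - {a}" for x y using Suc.prems(2) that by blast
    show "(\<Sum>j\<le>n. x ^ j * d j) = 0" if x: "x \<in> S - {a}" for x
    proof -
      have "0 = (\<Sum>i\<le>Suc n. x ^ i * c i) - (\<Sum>i\<le>Suc n. a ^ i * c i)"
        using Suc.prems(3) x a by (metis DiffD1 diff_zero)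
      also have "\<dots> = (\<Sum>i\<le>Suc n. (x ^ i - a ^ i) * c i)"
        by (simp only: sum_subtractf left_diff_distrib)
      also have "\<dots> = (x - a) * (\<Sum>i\<le>Suc n. \<Sum>j<i. x ^ j * (a ^ (i - Suc j) * c i))"
        using diff_power_eq_commuting[OF Suc.prems(2)] x
        by (simp add: sum_distrib_left sum_distrib_right mult.assoc del: sum.atMost_Suc)
      also have "(\<Sum>i\<le>Suc n. \<Sum>j<i. x ^ j * (a ^ (i - Suc j) * c i)) = (\<Sum>j\<le>n. x ^ j * d j)"
        by (simp only: sum.nested_swap' d_def sum_distrib_left lessThan_Suc_atMost)
      finally show ?thesis using x by simp
    qed
  qed
  then show ?case by (simp add: d_def)
qed

lemma add_one_power_eq_binomial_sum:
  fixes x :: "'a::ring_1"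
  shows "(x + 1) ^ n = (\<Sum>i\<le>n. of_nat (n choose i) * x ^ i)"
proof (induction n)
  case 0
  show ?case by simp
next
  case (Suc n)
  have "(\<Sum>i\<le>Suc n. of_nat (Suc n choose i) * x ^ i)
      = 1 + ((\<Sum>i\<le>n. of_nat (n choose i) * x ^ Suc i) + (\<Sum>i\<le>n. of_nat (n choose Suc i) * x ^ Suc i))"
    by (simp only: sum.atMost_Suc_shift binomial_Suc_Suc of_nat_add distrib_right sum.distrib) simp
  also have "\<dots> = (\<Sum>i\<le>n. of_nat (n choose i) * x ^ Suc i) + (\<Sum>i\<le>Suc n. of_nat (n choose i) * x ^ i)"
    by (simp only: sum.atMost_Suc_shift) (simp add: add_ac)
  also have "(\<Sum>i\<le>Suc n. of_nat (n choose i) * x ^ i) = (x + 1) ^ n"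
    by (simp add: Suc binomial_eq_0)
  also have "(\<Sum>i\<le>n. of_nat (n choose i) * x ^ Suc i) = (x + 1) ^ n * x"
    by (simp only: Suc sum_distrib_right power_Suc2 mult.assoc)
  finally show ?case by (simp add: power_Suc2 distrib_left del: power_Suc)
qed

lemma additive_of_nat_mult:
  fixes f :: "'a::ring_1 \<Rightarrow> 'b::ring_1"
  assumes "Modules.additive f"
  shows "f (of_nat k * x) = of_nat k * f x"
proof -
  interpret additive f by fact
  show ?thesis by (induction k) (simp_all add: zero add distrib_right)
qed

text \<open>The function \<open>g\<close> disappears because \<open>1/x - 1/(x + 1) = 1/(x\<^sup>2 + x)\<close> is a linear
  relation between inverses of elements on which \<open>f\<close> is known from \<open>f(x)\<close>, \<open>f(1)\<close> and
  \<open>f(x\<^sup>2)\<close>. At \<open>x = 0\<close> and \<open>x = -1\<close>, where it has poles, the result is additivity of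
  \<open>f\<close> alone; at \<open>x = 0\<close> this uses \<open>n > 0\<close>.\<close>

lemma additive_square_identity:
  fixes f g :: "'a::division_ring \<Rightarrow> 'a"
  assumes "n > 0" and f: "Modules.additive f" and g: "Modules.additive g"
    and fg: "\<And>x. x \<noteq> 0 \<Longrightarrow> f x + x ^ n * g (inverse x) = 0"
  shows "f (x ^ 2) = ((x + 1) ^ n - x ^ n - 1) * f x - x ^ n * f 1"
proof -
  interpret f: additive f by (rule f)
  interpret g: additive g by (rule g)
  consider "x = 0" | "x = -1" | "x \<noteq> 0" "x + 1 \<noteq> 0"
    by (metis add_eq_0_iff minus_minus)
  then show ?thesis
  proof cases
    case 3
    define y where "y = x + 1"
    have y: "y \<noteq> 0" using 3 by (simp add: y_def)
    have comm: "x * y = y * x" by (simp add: y_def algebra_simps)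
    have xy: "x * y = x ^ 2 + x" by (simp add: y_def algebra_simps power2_eq_square)
    have "inverse x - inverse y = inverse y * (y - x) * inverse x"
      using 3 y by (simp add: algebra_simps mult.assoc)
    also have "\<dots> = inverse (x * y)"
      using 3 y by (simp add: y_def nonzero_inverse_mult_distrib)
    finally have part: "inverse x - inverse y = inverse (x * y)" .
    have pow: "(x * y) ^ n = y ^ n * x ^ n" "(x * y) ^ n = x ^ n * y ^ n"
      using comm power_mult_distrib_commuting by metis+
    have "f (x * y) = - ((x * y) ^ n * g (inverse (x * y)))"
      using fg[of "x * y"] 3 y by (simp add: eq_neg_iff_add_eq_0)
    also have "\<dots> = - (y ^ n * (x ^ n * g (inverse x))) + x ^ n * (y ^ n * g (inverse y))"
      unfolding part[symmetric] g.diff by (simp add: right_diff_distrib pow mult.assoc[symmetric])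
        (metis pow)
    also have "x ^ n * g (inverse x) = - f x"
      using fg[of x] 3 by (simp add: eq_neg_iff_add_eq_0 add.commute)
    also have "y ^ n * g (inverse y) = - f y"
      using fg[of y] y by (simp add: eq_neg_iff_add_eq_0 add.commute)
    finally show ?thesis
      unfolding xy by (simp add: f.add y_def algebra_simps)
  qed (use \<open>n > 0\<close> in \<open>auto simp: f.zero f.minus algebra_simps\<close>)
qed

theorem theorem1p5:
  fixes n :: nat
    and f g :: "'a :: division_ring \<Rightarrow> 'a"
  assumes "n \<ge> 3"
    and "CHAR('a) > n \<or> CHAR('a) = 0"
    and "Modules.additive f" and "Modules.additive g"
    and "\<forall>x. x \<noteq> 0 \<longrightarrow> f x + x ^ n * g (inverse x) = 0"
  shows "f = (\<lambda>_. 0) \<and> g = (\<lambda>_. 0)"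
proof -
  interpret f: additive f by fact
  interpret g: additive g by fact
  have of_nat_nz: "of_nat k \<noteq> (0 :: 'a)" if "0 < k" "k \<le> n" for k
    using assms(2) that by (auto simp: of_nat_eq_0_iff_char_dvd dest: dvd_imp_le)
  have inj: "inj_on (of_nat :: nat \<Rightarrow> 'a) {..n}"
  proof (rule linorder_inj_onI)
    fix k l assume "k < l" "k \<in> {..n}" "l \<in> {..n}"
    then show "of_nat k \<noteq> (of_nat l :: 'a)"
      using of_nat_nz[of "l - k"] by (simp add: of_nat_diff) fastforce
  qed auto
  have lead: "of_nat n * x ^ (n - 1) * f x = x ^ n * f 1" for x
  proof -
    \<comment> \<open>The coefficients of the polynomial in \<open>k\<close> obtained by substituting \<open>k x\<close> for \<open>x\<close> in the
      square identity. The factor \<open>f (k x) = k f x\<close> shifts the binomial coefficients by one.\<close>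
    define c where "c i = (if i < 2 then 0 else of_nat (n choose (i - 1)) * x ^ (i - 1) * f x)
        - (if i = 2 then f (x ^ 2) else 0) - (if i = n then x ^ n * f 1 else 0)" for i
    have "c n = 0"
    proof (rule leading_coeff_eq_0_if_central_roots)
      show "card (of_nat ` {..n} :: 'a set) > n" by (simp add: card_image[OF inj])
      show "z * y = y * z" if "z \<in> of_nat ` {..n}" for z y :: 'a
        using that by (auto simp: mult_of_nat_commute)
      show "(\<Sum>i\<le>n. z ^ i * c i) = 0" if "z \<in> of_nat ` {..n}" for z :: 'a
      proof -
        obtain k where z: "z = of_nat k" using \<open>z \<in> _\<close> by blast
        obtain m where m: "n = Suc m" using assms(1) by (cases n) auto
        have zc: "z * y = y * z" for y by (simp add: z mult_of_nat_commute)
        have zx: "(z * x) ^ i = z ^ i * x ^ i" for i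
          by (rule power_mult_distrib_commuting) (rule zc)
        have fz: "f (z * y) = z * f y" for y
          unfolding z by (rule additive_of_nat_mult) fact
        have "z ^ 2 * f (x ^ 2) = f ((z * x) ^ 2)"
          unfolding zx by (simp add: fz power2_eq_square[of z] mult.assoc)
        also have "\<dots> = ((z * x + 1) ^ n - (z * x) ^ n - 1) * f (z * x) - (z * x) ^ n * f 1"
          using assms by (intro additive_square_identity[where g = g]) auto
        also have "(z * x + 1) ^ n - (z * x) ^ n - 1 = (\<Sum>i<m. of_nat (n choose Suc i) * (z * x) ^ Suc i)"
          unfolding add_one_power_eq_binomial_sum m sum.atMost_Suc_shift
          unfolding lessThan_Suc_atMost[symmetric] sum.lessThan_Suc
          by (simp del: binomial_Suc_Suc power_Suc)
        also have "\<dots> * f (z * x) = (\<Sum>i<m. z ^ (i + 2) * (of_nat (n choose Suc i) * x ^ Suc i * f x))"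
          unfolding sum_distrib_right
        proof (rule sum.cong)
          fix i
          have "of_nat (n choose Suc i) * (z * x) ^ Suc i * f (z * x)
            = of_nat (n choose Suc i) * z ^ Suc i * (x ^ Suc i * z) * f x"
            by (simp only: zx fz mult.assoc)
          also have "\<dots> = of_nat (n choose Suc i) * z ^ (i + 2) * (x ^ Suc i * f x)"
            unfolding zc[of "x ^ Suc i", symmetric] add_2_eq_Suc' power_Suc2[of z "Suc i"]
            by (simp only: mult.assoc)
          also have "\<dots> = z ^ (i + 2) * (of_nat (n choose Suc i) * x ^ Suc i * f x)"
            unfolding mult_of_nat_commute[of _ "z ^ (i + 2)"] by (simp only: mult.assoc)
          finally show "of_nat (n choose Suc i) * (z * x) ^ Suc i * f (z * x)
            = z ^ (i + 2) * (of_nat (n choose Suc i) * x ^ Suc i * f x)" .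
        qed simp
        also have "\<dots> = (\<Sum>i\<le>n. z ^ i * (if i < 2 then 0 else of_nat (n choose (i - 1)) * x ^ (i - 1) * f x))"
          unfolding m sum.atMost_Suc_shift
          unfolding lessThan_Suc_atMost[symmetric] sum.lessThan_Suc_shift
          by (simp del: binomial_Suc_Suc)
        finally have id: "z ^ 2 * f (x ^ 2) = \<dots> - z ^ n * (x ^ n * f 1)"
          by (simp add: zx mult.assoc)
        have "(\<Sum>i\<le>n. z ^ i * (if i = 2 then f (x ^ 2) else 0)) = z ^ 2 * f (x ^ 2)"
          using assms(1) by (simp add: if_distrib cong: if_cong)
        moreover have "(\<Sum>i\<le>n. z ^ i * (if i = n then x ^ n * f 1 else 0)) = z ^ n * (x ^ n * f 1)"
          by (simp add: if_distrib cong: if_cong)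
        ultimately show ?thesis
          unfolding c_def right_diff_distrib sum_subtractf using id by simp
      qed
    qed
    then show ?thesis
      using assms(1) by (cases n) (simp_all add: c_def)
  qed
  have "of_nat (n - 1) * f 1 = 0"
    using lead[of 1] assms(1) by (simp add: of_nat_diff left_diff_distrib)
  then have f1: "f 1 = 0"
    using of_nat_nz[of "n - 1"] assms(1) by simp
  have f0: "f x = 0" for x
    using lead[of x] of_nat_nz[of n] assms(1) f1 by (cases "x = 0") (auto simp: f.zero)
  have "g x = 0" for x
    using assms(5)[rule_format, of "inverse x"] by (cases "x = 0") (auto simp: f0 g.zero)
  with f0 show ?thesis by blast
qed

end
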